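(* Let $\varepsilon>0$, let $f,Q\in C^2(\mathbb{R})$ with $Q$ satisfying $$Q(0)=0,\qquad \lim_{s\to\pm\infty}Q(s)=\pm Q_\infty,\qquad Q'(s)>0\ \ \forall s\in\mathbb{R},\qquad \lim_{|s|\to\infty}Q'(s)=0,$$ and consider the boundary value problem $$Q(\varepsilon v_x)_x=f(v)_x,\quad x\in(-\ell,\ell),\qquad v(\pm\ell)=u_\pm,$$ for some $u_-<u_+$. There exists a unique (smooth) increasing solution to this boundary value problem if and only if $$M-m<Q_\infty\qquad\text{and}\qquad \frac{2\ell}{\varepsilon}>A,$$ where $$m:=\min_{u\in[u_-,u_+]}f(u),\qquad M:=\max_{u\in[u_-,u_+]}f(u),\qquad A:=\int_{u_-}^{u_+}\frac{ds}{Q^{-1}\left(f(s)+Q_\infty-M\right)}.$$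
   Context: $\ell>0$ is fixed and $Q_\infty\in(0,\infty)$. Since $Q$ is strictly increasing it is a bijection $\mathbb{R}\to(-Q_\infty,Q_\infty)$ with inverse $Q^{-1}$; in the definition of $A$ the integrand is understood to be $0$ at points $s$ where $f(s)=M$ (where $Q^{-1}(Q_\infty)=+\infty$). A smooth solution is a classical solution, regular up to the boundary ($v\in C^2([-\ell,\ell])$). *)

theory Defs
  imports "HOL-Analysis.Analysis"
begin

text \<open>One-sided derivatives at the end points of an interval \<open>S\<close>, so that
  \<open>C2_on {a..b} v\<close> is regularity up to the boundary.\<close>

definition C2_on :: "real set \<Rightarrow> (real \<Rightarrow> real) \<Rightarrow> bool" where
  "C2_on S g \<longleftrightarrow>
     (\<exists>g' g''. (\<forall>x\<in>S. (g has_real_derivative g' x) (at x within S) \<and>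
                      (g' has_real_derivative g'' x) (at x within S)) \<and>
              continuous_on S g'')"

definition min_on :: "(real \<Rightarrow> real) \<Rightarrow> real set \<Rightarrow> real" where
  "min_on f S = (LEAST y. y \<in> f ` S)"

definition max_on :: "(real \<Rightarrow> real) \<Rightarrow> real set \<Rightarrow> real" where
  "max_on f S = (GREATEST y. y \<in> f ` S)"

text \<open>All expressions under \<open>deriv\<close> are differentiable at the interior points when
  \<open>f\<close>, \<open>Q\<close> and \<open>v\<close> are \<open>C\<^sup>2\<close>, so the equation carries no unspecified values.
  Only the values of \<open>v\<close> on \<open>{-L..L}\<close> matter.\<close>

definition smooth_solution ::
  "(real \<Rightarrow> real) \<Rightarrow> (real \<Rightarrow> real) \<Rightarrow> real \<Rightarrow> real \<Rightarrow> real \<Rightarrow> real \<Rightarrow> (real \<Rightarrow> real) \<Rightarrow> bool" where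
  "smooth_solution f Q \<epsilon> L um up v \<longleftrightarrow>
     C2_on {-L..L} v \<and>
     (\<forall>x\<in>{-L<..<L}.
        deriv (\<lambda>y. Q (\<epsilon> * deriv v y)) x = deriv (\<lambda>y. f (v y)) x) \<and>
     v (-L) = um \<and> v L = up"

text \<open>The case \<open>f s = M\<close> is the convention \<open>1 / Q\<^sup>-\<^sup>1(Q\<^sub>\<infinity>) = 1 / \<infinity> = 0\<close>. If
  \<open>M - m < Q\<^sub>\<infinity>\<close>, all other arguments of \<open>inv Q\<close> lie in the range of \<open>Q\<close> and the
  integrand is continuous on \<open>{um..up}\<close>; otherwise the value is not meaningful.\<close>

definition A_integral ::
  "(real \<Rightarrow> real) \<Rightarrow> (real \<Rightarrow> real) \<Rightarrow> real \<Rightarrow> real \<Rightarrow> real \<Rightarrow> real" where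
  "A_integral f Q Qinf um up =
     (let M = max_on f {um..up} in
      integral {um..up} (\<lambda>s. if f s = M then 0 else 1 / inv Q (f s + Qinf - M)))"

end

theory Submission
  imports Defs
begin

text \<open>
  Integrating the equation once gives \<open>Q (\<epsilon> * v') = f v + C\<close> with a constant \<open>C\<close>
  (\<open>solution_imp_trajectory\<close>). A strictly increasing solution has \<open>v' > 0\<close> on the whole closed interval,
  because a critical point would be an equilibrium of this first-order autonomous equation with locally
  Lipschitz right-hand side (\<open>increasing_solution_slope_pos\<close>). Hence \<open>0 < f u + C < Qinf\<close> for all
  \<open>u \<in> {um..up}\<close>, that is, \<open>- m < C < Qinf - M\<close>; such a \<open>C\<close> exists iff \<open>M - m < Qinf\<close>.

  For such a \<open>C\<close> the equation \<open>\<epsilon> * v' = inv Q (f v + C)\<close> is solved by separation of variables. A solution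
  climbs from \<open>um\<close> to \<open>up\<close> on an interval of length \<open>\<epsilon> * T C\<close>, where \<open>T C\<close> is the integral of
  \<open>1 / inv Q (f s + C)\<close> over \<open>{um..up}\<close>. So the increasing solutions correspond exactly to the
  admissible \<open>C\<close> with \<open>T C = 2 * L / \<epsilon>\<close>.

  It remains to find the range of \<open>T\<close>. It is strictly decreasing and continuous, and with the convention
  \<open>1 / \<infinity> = 0\<close> it extends continuously to \<open>C = Qinf - M\<close>, where its value is \<open>A\<close>. At the other end it
  tends to infinity, because \<open>f\<close> is Lipschitz continuous and so \<open>1 / inv Q (f s + C)\<close> approaches at least
  a multiple of \<open>1 / \<bar>s - s0\<bar>\<close> near a minimum point \<open>s0\<close> (\<open>transit_time_unbounded\<close>). By the intermediate value
  theorem the range is the interval of all values above \<open>A\<close>, and strict monotonicity makes \<open>C\<close>, and with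
  it the solution, unique.
\<close>

section \<open>Continuously differentiable functions and extrema on an interval\<close>

lemma C2_on_UNIV_DERIV:
  assumes "C2_on UNIV g"
  shows "(g has_real_derivative deriv g x) (at x)"
    and "continuous_on UNIV g" and "continuous_on UNIV (deriv g)"
proof -
  from assms obtain g' g'' where g: "\<And>x. (g has_real_derivative g' x) (at x)"
      "\<And>x. (g' has_real_derivative g'' x) (at x)"
    unfolding C2_on_def by auto
  then have d: "deriv g = g'"
    by (auto intro: DERIV_imp_deriv)
  show "(g has_real_derivative deriv g x) (at x)"
    using g d by simp
  show "continuous_on UNIV g" "continuous_on UNIV (deriv g)"
    using g d by (auto intro!: DERIV_continuous_on)
qed

lemma lipschitz_from_point:
  fixes g :: "real \<Rightarrow> real"
  assumes "C2_on UNIV g" and "a < b"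
  obtains K where "K > 0" and "\<And>s t. s \<in> {a..b} \<Longrightarrow> t \<in> {a..b} \<Longrightarrow> \<bar>g s - g t\<bar> \<le> K * \<bar>s - t\<bar>"
proof -
  have "compact (deriv g ` {a..b})"
    by (intro compact_continuous_image continuous_on_subset[OF C2_on_UNIV_DERIV(3)[OF assms(1)]]) auto
  then obtain K where K: "K > 0" "\<And>x. x \<in> {a..b} \<Longrightarrow> \<bar>deriv g x\<bar> \<le> K"
    by (auto dest!: compact_imp_bounded simp: bounded_pos)
  have "norm (g s - g t) \<le> K * norm (s - t)" if "s \<in> {a..b}" "t \<in> {a..b}" for s t
    by (rule field_differentiable_bound[of "{a..b}" g "deriv g" K])
       (use K that C2_on_UNIV_DERIV(1)[OF assms(1)] in \<open>auto intro: has_field_derivative_at_within\<close>)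
  with K(1) that show ?thesis by auto
qed

lemma max_on_Icc:
  fixes f :: "real \<Rightarrow> real"
  assumes "continuous_on {a..b} f" and "a \<le> b"
  shows "max_on f {a..b} \<in> f ` {a..b}" and "\<And>s. s \<in> {a..b} \<Longrightarrow> f s \<le> max_on f {a..b}"
proof -
  obtain x where x: "x \<in> {a..b}" "\<And>y. y \<in> {a..b} \<Longrightarrow> f y \<le> f x"
    using continuous_attains_sup[of "{a..b}" f] assms by auto
  then have "max_on f {a..b} = f x"
    unfolding max_on_def by (intro Greatest_equality) auto
  with x show "max_on f {a..b} \<in> f ` {a..b}" "\<And>s. s \<in> {a..b} \<Longrightarrow> f s \<le> max_on f {a..b}"
    by auto
qed

lemma min_on_Icc:
  fixes f :: "real \<Rightarrow> real"
  assumes "continuous_on {a..b} f" and "a \<le> b"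
  shows "min_on f {a..b} \<in> f ` {a..b}" and "\<And>s. s \<in> {a..b} \<Longrightarrow> min_on f {a..b} \<le> f s"
proof -
  obtain x where x: "x \<in> {a..b}" "\<And>y. y \<in> {a..b} \<Longrightarrow> f x \<le> f y"
    using continuous_attains_inf[of "{a..b}" f] assms by auto
  then have "min_on f {a..b} = f x"
    unfolding min_on_def by (intro Least_equality) auto
  with x show "min_on f {a..b} \<in> f ` {a..b}" "\<And>s. s \<in> {a..b} \<Longrightarrow> min_on f {a..b} \<le> f s"
    by auto
qed

section \<open>Gronwall's inequality and a logarithmic integral\<close>

text \<open>Gronwall's inequality in the sign-preserving form: \<open>w x * exp (- K * x)\<close> is nonincreasing.
  It replaces a uniqueness theorem for ordinary differential equations: a solution that touches an
  equilibrium cannot leave it.\<close>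

lemma gronwall_nonpos:
  fixes w :: "real \<Rightarrow> real"
  assumes "a \<le> b" and "continuous_on {a..b} w"
    and "\<And>x. a < x \<Longrightarrow> x < b \<Longrightarrow> (w has_real_derivative w' x) (at x)"
    and "\<And>x. a < x \<Longrightarrow> x < b \<Longrightarrow> w' x \<le> K * w x"
    and "w a \<le> 0"
  shows "w b \<le> 0"
proof -
  let ?h = "\<lambda>x. w x * exp (- K * x)"
  have "?h b \<le> ?h a"
  proof (rule DERIV_nonpos_imp_decreasing_open[OF assms(1)])
    fix x assume x: "a < x" "x < b"
    have "(?h has_real_derivative (w' x - K * w x) * exp (- K * x)) (at x)"
      by (auto intro!: derivative_eq_intros assms(3) x simp: algebra_simps)
    moreover have "(w' x - K * w x) * exp (- K * x) \<le> 0"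
      using assms(4)[OF x] by (intro mult_nonpos_nonneg) auto
    ultimately show "\<exists>y. (?h has_real_derivative y) (at x) \<and> y \<le> 0" by blast
  qed (intro continuous_intros assms)
  also have "\<dots> \<le> 0" using assms(5) by (simp add: mult_nonpos_nonneg)
  finally show ?thesis by (simp add: mult_le_0_iff)
qed

text \<open>The two sides of \<open>s0\<close> contribute logarithms of \<open>1 + p / \<delta>\<close> and \<open>1 + q / \<delta>\<close>, where
  \<open>p + q = K * (b - a)\<close>. Since \<open>(1 + p / \<delta>) * (1 + q / \<delta>) \<ge> 1 + (p + q) / \<delta>\<close>, the bound does not depend
  on the position of \<open>s0\<close> in the interval, even at an end point, and it tends to infinity as
  \<open>\<delta>\<close> tends to \<open>0\<close>.\<close>

lemma integral_reciprocal_distance_ge: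
  fixes a b s0 K \<delta> :: real
  assumes "K > 0" "\<delta> > 0" "a \<le> s0" "s0 \<le> b"
  shows "ln (1 + K * (b - a) / \<delta>) / K \<le> integral {a..b} (\<lambda>s. 1 / (K * \<bar>s - s0\<bar> + \<delta>))"
proof -
  let ?g = "\<lambda>s. 1 / (K * \<bar>s - s0\<bar> + \<delta>)"
  have L: "(?g has_integral (- ln (K * (s0 - s0) + \<delta>) / K - - ln (K * (s0 - a) + \<delta>) / K)) {a..s0}"
  proof (rule fundamental_theorem_of_calculus[OF assms(3)])
    fix x assume "x \<in> {a..s0}"
    then have "K * (s0 - x) + \<delta> > 0" "\<bar>x - s0\<bar> = s0 - x" using assms by (auto intro: add_nonneg_pos)
    then show "((\<lambda>s. - ln (K * (s0 - s) + \<delta>) / K) has_vector_derivative ?g x) (at x within {a..s0})"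
      unfolding has_real_derivative_iff_has_vector_derivative[symmetric] using assms
      by (auto intro!: derivative_eq_intros)
  qed
  have R: "(?g has_integral (ln (K * (b - s0) + \<delta>) / K - ln (K * (s0 - s0) + \<delta>) / K)) {s0..b}"
  proof (rule fundamental_theorem_of_calculus[OF assms(4)])
    fix x assume "x \<in> {s0..b}"
    then have "K * (x - s0) + \<delta> > 0" "\<bar>x - s0\<bar> = x - s0" using assms by (auto intro: add_nonneg_pos)
    then show "((\<lambda>s. ln (K * (s - s0) + \<delta>) / K) has_vector_derivative ?g x) (at x within {s0..b})"
      unfolding has_real_derivative_iff_has_vector_derivative[symmetric] using assms
      by (auto intro!: derivative_eq_intros)
  qed
  define p q where "p = K * (s0 - a)" and "q = K * (b - s0)"
  have pq: "p \<ge> 0" "q \<ge> 0" using assms by (auto simp: p_def q_def)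
  have "integral {a..b} ?g = (ln (p + \<delta>) - ln \<delta> + (ln (q + \<delta>) - ln \<delta>)) / K"
    using has_integral_combine[OF assms(3,4) L R]
    by (simp add: integral_unique p_def q_def add_divide_distrib diff_divide_distrib)
  also have "ln (p + \<delta>) - ln \<delta> + (ln (q + \<delta>) - ln \<delta>) = ln ((p + \<delta>) / \<delta> * ((q + \<delta>) / \<delta>))"
    using pq assms by (simp add: ln_mult ln_div)
  also have "(p + \<delta>) / \<delta> * ((q + \<delta>) / \<delta>) = 1 + (p + q) / \<delta> + p * q / \<delta>\<^sup>2"
    using assms by (simp add: field_simps power2_eq_square)
  also have "p + q = K * (b - a)" by (simp add: p_def q_def algebra_simps)
  finally have eq: "integral {a..b} ?g = ln (1 + K * (b - a) / \<delta> + p * q / \<delta>\<^sup>2) / K" .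
  moreover have "0 \<le> p * q / \<delta>\<^sup>2" "0 \<le> K * (b - a) / \<delta>" using pq assms by auto
  ultimately have "ln (1 + K * (b - a) / \<delta>) \<le> ln (1 + K * (b - a) / \<delta> + p * q / \<delta>\<^sup>2)"
    by (subst ln_le_cancel_iff) linarith+
  with eq assms(1) show ?thesis by (simp add: divide_right_mono)
qed

section \<open>Separation of variables\<close>

text \<open>Separation of variables for \<open>v' = 1 / r (v)\<close>: a primitive of \<open>r\<close>, composed with \<open>v\<close>, has derivative \<open>1\<close>.\<close>

lemma elapsed_time_eq_integral:
  fixes v r :: "real \<Rightarrow> real"
  assumes r: "continuous_on {a..b} r" "\<And>s. s \<in> {a..b} \<Longrightarrow> r s \<noteq> 0"
    and v: "v ` {x0..x1} \<subseteq> {a..b}" "v x0 = a"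
      "\<And>x. x \<in> {x0..x1} \<Longrightarrow> (v has_real_derivative 1 / r (v x)) (at x within {x0..x1})"
    and x: "x \<in> {x0..x1}"
  shows "integral {a..v x} r = x - x0"
proof -
  let ?H = "\<lambda>u. integral {a..u} r"
  have "((\<lambda>x. ?H (v x) - x) has_real_derivative 0) (at x within {x0..x1})" if x: "x \<in> {x0..x1}" for x
  proof -
    have "v x \<in> {a..b}" using v(1) x by (rule subsetD[OF _ imageI])
    then have "(?H has_real_derivative r (v x)) (at (v x) within v ` {x0..x1})"
      using integral_has_real_derivative[OF r(1)] v(1) by (blast intro: has_field_derivative_subset)
    from DERIV_image_chain[OF this v(3)[OF x]]
    show ?thesis using r(2)[OF \<open>v x \<in> {a..b}\<close>]
      by (auto intro!: derivative_eq_intros simp: o_def)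
  qed
  then obtain c where c: "\<And>x. x \<in> {x0..x1} \<Longrightarrow> ?H (v x) - x = c"
    using has_field_derivative_zero_constant[of "{x0..x1}" "\<lambda>x. ?H (v x) - x"] by auto
  from c[of x0] c[of x] x v(2) show ?thesis by auto
qed

text \<open>Conversely, the inverse of a primitive of \<open>r\<close> solves \<open>v' = 1 / r (v)\<close>.\<close>

lemma solution_by_quadrature:
  fixes r :: "real \<Rightarrow> real"
  assumes ab: "a < b" and r: "continuous_on {a..b} r" "\<And>s. s \<in> {a..b} \<Longrightarrow> r s > 0"
    and x1: "x1 - x0 = integral {a..b} r"
  obtains v where "v x0 = a" "v x1 = b" "v ` {x0..x1} \<subseteq> {a..b}"
    "\<And>x. x \<in> {x0..x1} \<Longrightarrow> (v has_real_derivative 1 / r (v x)) (at x within {x0..x1})"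
proof -
  \<comment> \<open>Constant continuation of \<open>r\<close> beyond the end points lets the primitive be inverted on an
    open interval, so that two-sided derivatives suffice also at \<open>a\<close> and \<open>b\<close>.\<close>
  define R where "R s = r (max a (min b s))" for s
  have R_cont: "continuous_on UNIV R" unfolding R_def
    by (rule continuous_on_compose2[OF r(1)]) (use ab in \<open>auto intro!: continuous_intros\<close>)
  have R_pos: "R s > 0" for s unfolding R_def by (rule r(2)) (use ab in auto)
  have R_eq: "R s = r s" if "s \<in> {a..b}" for s using that by (simp add: R_def)
  have R_int: "R integrable_on {c..d}" for c d
    using R_cont by (blast intro: integrable_continuous_real continuous_on_subset)
  define H where "H u = x0 - integral {a - 1..a} R + integral {a - 1..u} R" for u
  have H_deriv: "(H has_real_derivative R u) (at u)" if "a - 1 < u" "u < b + 1" for u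
  proof -
    have "((\<lambda>u. integral {a - 1..u} R) has_real_derivative R u) (at u within {a - 1..b + 1})"
      using that by (intro integral_has_real_derivative continuous_on_subset[OF R_cont]) auto
    then show ?thesis unfolding H_def using that
      by (auto intro!: derivative_eq_intros simp: at_within_Icc_at)
  qed
  have H_mono: "H s < H t" if "a - 1 < s" "s < t" "t < b + 1" for s t
  proof (rule DERIV_pos_imp_increasing[OF that(2)])
    fix x assume "s \<le> x" "x \<le> t"
    then show "\<exists>y. (H has_real_derivative y) (at x) \<and> 0 < y"
      using H_deriv[of x] R_pos[of x] that by auto
  qed
  have H_inj: "inj_on H {a - 1<..<b + 1}"
    by (rule strict_mono_on_imp_inj_on) (auto simp: strict_mono_on_def H_mono)
  have H_isCont: "isCont H u" if "a - 1 < u" "u < b + 1" for u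
    using H_deriv[OF that] by (rule DERIV_isCont)
  have Ha: "H a = x0" by (simp add: H_def)
  have "integral {a - 1..b} R = integral {a - 1..a} R + integral {a..b} R"
    using Henstock_Kurzweil_Integration.integral_combine[of "a - 1" a b R] R_int ab by simp
  moreover have "integral {a..b} R = integral {a..b} r" by (rule integral_cong) (rule R_eq)
  ultimately have Hb: "H b = x1" using x1 by (simp add: H_def)
  define v where "v = inv_into {a - 1<..<b + 1} H"
  have vH: "v (H u) = u" if "a - 1 < u" "u < b + 1" for u
    unfolding v_def using H_inj that by (intro inv_into_f_f) auto
  have Hv: "H (v y) = y" if "H (a - 1/2) < y" "y < H (b + 1/2)" for y
  proof -
    have "\<exists>u\<ge>a - 1/2. u \<le> b + 1/2 \<and> H u = y"
      using that ab by (intro IVT') (auto intro!: continuous_at_imp_continuous_on H_isCont)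
    then obtain u where "a - 1/2 \<le> u" "u \<le> b + 1/2" "H u = y" by blast
    then show ?thesis using vH[of u] by auto
  qed
  have reach: "\<exists>u\<in>{a..b}. H u = x" if "x \<in> {x0..x1}" for x
  proof -
    have "\<exists>u\<ge>a. u \<le> b \<and> H u = x"
      using that ab Ha Hb by (intro IVT') (auto intro!: continuous_at_imp_continuous_on H_isCont)
    then show ?thesis by auto
  qed
  show ?thesis
  proof
    show "v x0 = a" "v x1 = b" using vH[of a] vH[of b] Ha Hb ab by auto
    show "v ` {x0..x1} \<subseteq> {a..b}" using reach vH by force
    fix x assume "x \<in> {x0..x1}"
    then obtain u where u: "u \<in> {a..b}" "H u = x" using reach by blast
    then have vx: "v x = u" using vH[of u] by auto
    have "isCont v (H u)"
      by (rule isCont_inverse_function2[of "u - 1/2" u "u + 1/2"]) (use u in \<open>auto intro: vH H_isCont\<close>)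
    moreover have "H (a - 1/2) < x" "x < H (b + 1/2)"
      using u H_mono[of "a - 1/2" u] H_mono[of u "b + 1/2"] by auto
    ultimately have "(v has_real_derivative inverse (R u)) (at x)"
      using u vx R_pos[of u] Hv
      by (intro DERIV_inverse_function[where f = H and a = "H (a - 1/2)" and b = "H (b + 1/2)"])
         (auto intro!: H_deriv)
    then show "(v has_real_derivative 1 / r (v x)) (at x within {x0..x1})"
      using vx R_eq[OF u(1)] by (auto intro: has_field_derivative_at_within simp: inverse_eq_divide)
  qed
qed

section \<open>The inverse of the flux function\<close>

text \<open>The function \<open>inv Q\<close> turns a flux into the slope that produces it. Slopes of increasing solutions are
  positive, so their fluxes lie in \<open>{0<..<Qinf}\<close>.\<close>

locale saturating_flux =
  fixes Q :: "real \<Rightarrow> real" and Qinf :: real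
  assumes Q_C2: "C2_on UNIV Q"
    and Q_0: "Q 0 = 0"
    and Q_top: "(Q \<longlongrightarrow> Qinf) at_top"
    and Q_deriv_pos: "deriv Q s > 0"
begin

lemmas Q_DERIV = C2_on_UNIV_DERIV(1)[OF Q_C2]

lemma Q_strict_mono: "strict_mono Q"
proof (rule strict_monoI)
  show "Q x < Q y" if "x < y" for x y
    by (rule DERIV_pos_imp_increasing[OF that]) (use Q_DERIV Q_deriv_pos in blast)
qed

lemma inv_Q_Q [simp]: "inv Q (Q p) = p"
  by (rule inv_f_f) (rule strict_mono_imp_inj_on[OF Q_strict_mono])

lemma Q_less_iff [simp]: "Q p < Q q \<longleftrightarrow> p < q"
  by (rule strict_mono_less[OF Q_strict_mono])

lemma Q_less_Qinf: "Q s < Qinf"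
proof -
  have "Q (s + 1) \<le> Qinf"
  proof (rule tendsto_lowerbound[OF Q_top])
    show "eventually (\<lambda>t. Q (s + 1) \<le> Q t) at_top"
      using eventually_ge_at_top[of "s + 1"]
      by eventually_elim (simp add: strict_mono_less_eq[OF Q_strict_mono])
  qed simp
  moreover have "Q s < Q (s + 1)" by simp
  ultimately show ?thesis by linarith
qed

lemma Q_inv_Q: assumes "0 \<le> y" "y < Qinf" shows "Q (inv Q y) = y"
proof -
  have "eventually (\<lambda>t. y < Q t \<and> 0 \<le> t) at_top"
    using order_tendstoD(1)[OF Q_top assms(2)] eventually_ge_at_top[of 0] by eventually_elim auto
  then obtain t where "y < Q t" "0 \<le> t" using eventually_happens by force
  then have "\<exists>s\<ge>0. s \<le> t \<and> Q s = y"
    using assms Q_0 by (intro IVT') (auto intro: continuous_on_subset[OF C2_on_UNIV_DERIV(2)[OF Q_C2]])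
  then show ?thesis by auto
qed

lemma inv_Q_pos: "0 < y \<Longrightarrow> y < Qinf \<Longrightarrow> 0 < inv Q y"
  using Q_less_iff[of 0 "inv Q y"] by (simp add: Q_0 Q_inv_Q del: Q_less_iff)

lemma inv_Q_less: "0 \<le> x \<Longrightarrow> x < y \<Longrightarrow> y < Qinf \<Longrightarrow> inv Q x < inv Q y"
  using Q_less_iff[of "inv Q x" "inv Q y"] by (simp add: Q_inv_Q del: Q_less_iff)

lemma inv_Q_DERIV:
  assumes "0 < y" "y < Qinf"
  shows "(inv Q has_real_derivative inverse (deriv Q (inv Q y))) (at y)"
proof (rule DERIV_inverse_function[OF Q_DERIV])
  show "deriv Q (inv Q y) \<noteq> 0" using Q_deriv_pos by (metis less_irrefl)
  have "isCont (inv Q) (Q (inv Q y))"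
    by (rule isCont_inverse_function2[of "inv Q y - 1" _ "inv Q y + 1"]) (auto intro: DERIV_isCont Q_DERIV)
  then show "isCont (inv Q) y" using assms by (simp add: Q_inv_Q)
qed (use assms Q_inv_Q in auto)

text \<open>The lower bound controls \<open>p\<close> by \<open>Q p\<close>. It is used near \<open>p = 0\<close> for the blow-up of the transit time,
  and on the range of a given slope for the positivity of that slope.\<close>

lemma Q_ge_linear:
  assumes "B > 0"
  obtains c where "c > 0" "\<And>p. 0 \<le> p \<Longrightarrow> p \<le> B \<Longrightarrow> c * p \<le> Q p"
proof -
  have "\<exists>z\<in>{0..B}. \<forall>y\<in>{0..B}. deriv Q z \<le> deriv Q y"
    using assms continuous_on_subset[OF C2_on_UNIV_DERIV(3)[OF Q_C2]]
    by (intro continuous_attains_inf) auto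
  then obtain z where z: "\<And>y. y \<in> {0..B} \<Longrightarrow> deriv Q z \<le> deriv Q y" by blast
  have "deriv Q z * p \<le> Q p" if p: "0 \<le> p" "p \<le> B" for p
  proof -
    have "Q 0 - deriv Q z * 0 \<le> Q p - deriv Q z * p"
      by (rule DERIV_nonneg_imp_nondecreasing[OF p(1)])
         (use p z in \<open>auto intro!: derivative_eq_intros exI Q_DERIV\<close>)
    then show ?thesis by (simp add: Q_0)
  qed
  with Q_deriv_pos that show ?thesis by blast
qed

text \<open>The reciprocal of the slope \<open>inv Q y\<close>, continued by \<open>1 / \<infinity> = 0\<close> from \<open>Qinf\<close> on. With this
  continuation the integral \<open>A\<close> is an ordinary value of the transit time defined below.\<close>

definition slowness :: "real \<Rightarrow> real" where
  "slowness y = (if y < Qinf then 1 / inv Q y else 0)"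

lemma slowness_pos: "0 < y \<Longrightarrow> y < Qinf \<Longrightarrow> 0 < slowness y"
  by (simp add: slowness_def inv_Q_pos)

lemma slowness_nonneg: "0 < y \<Longrightarrow> 0 \<le> slowness y"
  using slowness_pos[of y] by (cases "y < Qinf") (auto simp: slowness_def)

lemma slowness_strict_antimono: "0 < x \<Longrightarrow> x < y \<Longrightarrow> x < Qinf \<Longrightarrow> slowness y < slowness x"
  using inv_Q_less[of x y] inv_Q_pos[of x] inv_Q_pos[of y]
  by (auto simp: slowness_def field_simps)

lemma slowness_antimono: "0 < x \<Longrightarrow> x \<le> y \<Longrightarrow> slowness y \<le> slowness x"
  using slowness_strict_antimono[of x y] by (cases "x < Qinf"; cases "x = y") (auto simp: slowness_def)

lemma isCont_slowness: assumes "0 < y" shows "isCont slowness y"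
proof (cases "y < Qinf")
  case True
  have "isCont (\<lambda>y. 1 / inv Q y) y"
    using inv_Q_pos[OF assms True] inv_Q_DERIV[OF assms True] by (intro continuous_intros) (auto dest: DERIV_isCont)
  moreover have "eventually (\<lambda>z. z < Qinf) (nhds y)"
    using True by (intro eventually_nhds_in_open[of "{..<Qinf}", simplified])
  then have "eventually (\<lambda>z. slowness z = 1 / inv Q z) (nhds y)"
    by eventually_elim (simp add: slowness_def)
  ultimately show ?thesis by (simp cong: isCont_cong)
next
  case False
  have "eventually (\<lambda>z. dist (slowness z) (slowness y) < e) (at y)" if "e > 0" for e
  proof -
    \<comment> \<open>Beyond \<open>Q (1 / e)\<close> the slope exceeds \<open>1 / e\<close>; this also covers the points from \<open>Qinf\<close> on.\<close>
    have "eventually (\<lambda>z. z \<in> {Q (1 / e)<..}) (at y)"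
      using False Q_less_Qinf[of "1 / e"] by (intro eventually_at_in_open') auto
    then show ?thesis
    proof eventually_elim
      case (elim z)
      then have z: "Q (1 / e) < z" by simp
      have "0 < Q (1 / e)" using \<open>e > 0\<close> Q_less_iff[of 0 "1 / e"] by (simp add: Q_0 del: Q_less_iff)
      moreover have "slowness z < slowness (Q (1 / e))"
        using z Q_less_Qinf \<open>0 < Q (1 / e)\<close> by (intro slowness_strict_antimono)
      moreover have "slowness (Q (1 / e)) = e" using Q_less_Qinf by (simp add: slowness_def)
      ultimately show ?case using slowness_nonneg[of z] z False by (simp add: slowness_def[of y])
    qed
  qed
  then show ?thesis unfolding isCont_def tendsto_iff by blast
qed

lemma continuous_on_slowness: "continuous_on {0<..} slowness"
  by (auto intro: continuous_at_imp_continuous_on isCont_slowness)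

text \<open>Near \<open>0\<close> the slope \<open>inv Q y\<close> is at most \<open>y / c\<close>. Subtracting the constant \<open>k\<close> makes the
  right-hand side trivial away from \<open>0\<close>, so that no smallness of \<open>y\<close> has to be required.\<close>

lemma slowness_ge_reciprocal:
  obtains c k where "c > 0" "\<And>y. 0 < y \<Longrightarrow> c / y - k \<le> slowness y"
proof -
  obtain c where c: "c > 0" "\<And>p. 0 \<le> p \<Longrightarrow> p \<le> 1 \<Longrightarrow> c * p \<le> Q p" using Q_ge_linear[of 1] by auto
  have Q1: "0 < Q 1" using Q_less_iff[of 0 1] by (simp add: Q_0 del: Q_less_iff)
  have "c / y - c / Q 1 \<le> slowness y" if y: "0 < y" for y
  proof (cases "y \<le> Q 1")
    case True
    then have less: "y < Qinf" using Q_less_Qinf[of 1] by simp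
    have P: "0 < inv Q y" "inv Q y \<le> 1"
      using inv_Q_pos[OF y less] Q_less_iff[of 1 "inv Q y"] True y less
      by (auto simp: Q_inv_Q simp del: Q_less_iff intro: leI)
    then have "c * inv Q y \<le> y" using c(2)[of "inv Q y"] y less by (simp add: Q_inv_Q)
    then have "c / y \<le> slowness y" using P y less by (simp add: slowness_def field_simps)
    moreover have "0 \<le> c / Q 1" using c Q1 by simp
    ultimately show ?thesis by linarith
  next
    case False
    then have "c / y \<le> c / Q 1" using c Q1 y by (intro divide_left_mono) auto
    then show ?thesis using slowness_nonneg[OF y] by linarith
  qed
  with c(1) that show ?thesis by blast
qed

section \<open>The transit time as a function of the constant of integration\<close>

text \<open>If \<open>0 < f s + C < Qinf\<close> between \<open>a\<close> and \<open>b\<close>, this is the length of the interval on which a solution of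
  \<open>Q (v' x) = f (v x) + C\<close> rises from \<open>a\<close> to \<open>b\<close>.\<close>

definition transit_time :: "(real \<Rightarrow> real) \<Rightarrow> real \<Rightarrow> real \<Rightarrow> real \<Rightarrow> real" where
  "transit_time f a b C = integral {a..b} (\<lambda>s. slowness (f s + C))"

lemma continuous_on_slowness_comp:
  assumes "continuous_on S f" "\<And>s. s \<in> S \<Longrightarrow> 0 < f s + C"
  shows "continuous_on S (\<lambda>s. slowness (f s + C))"
  by (rule continuous_on_compose2[OF continuous_on_slowness]) (use assms in \<open>auto intro!: continuous_intros\<close>)

lemma continuous_on_transit_time:
  assumes "continuous_on {a..b} f" "\<And>s. s \<in> {a..b} \<Longrightarrow> m \<le> f s"
  shows "continuous_on {- m<..} (transit_time f a b)"
proof -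
  have "continuous_on ({- m<..} \<times> cbox a b) (\<lambda>(C, s). slowness (f s + C))"
    unfolding case_prod_unfold
  proof (rule continuous_on_compose2[OF continuous_on_slowness])
    show "continuous_on ({- m<..} \<times> cbox a b) (\<lambda>x. f (snd x) + fst x)"
      by (intro continuous_intros continuous_on_compose2[OF assms(1)]) auto
  qed (use assms(2) in force)
  from integral_continuous_on_param[OF this] show ?thesis
    by (simp add: transit_time_def[abs_def])
qed

lemma transit_time_strict_antimono:
  assumes "continuous_on {a..b} f" "a < b" "C < D"
    and "\<And>s. s \<in> {a..b} \<Longrightarrow> 0 < f s + C" "\<And>s. s \<in> {a..b} \<Longrightarrow> f s + C < Qinf"
  shows "transit_time f a b D < transit_time f a b C"
  unfolding transit_time_def
proof (rule integral_less_real)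
  show "continuous_on {a..b} (\<lambda>s. slowness (f s + D))" "continuous_on {a..b} (\<lambda>s. slowness (f s + C))"
    using assms(3,4) by (force intro!: continuous_on_slowness_comp assms(1))+
  show "slowness (f s + D) < slowness (f s + C)" if "s \<in> {a<..<b}" for s
    using assms that by (intro slowness_strict_antimono) auto
qed (use assms(2) in auto)

text \<open>For \<open>C = - f s0 + \<delta>\<close>, where \<open>s0\<close> is a minimum point of \<open>f\<close>, the argument \<open>f s + C\<close> is at most
  \<open>K * \<bar>s - s0\<bar> + \<delta>\<close> with a Lipschitz constant \<open>K\<close>. Near \<open>s0\<close> the slope is at most proportional to that,
  so as \<open>\<delta>\<close> tends to \<open>0\<close> the transit time diverges at least logarithmically, even when \<open>s0\<close> is an end point at which
  \<open>f\<close> has nonzero slope.\<close>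

lemma transit_time_unbounded:
  assumes f: "C2_on UNIV f" and ab: "a < b"
    and m: "s0 \<in> {a..b}" "\<And>s. s \<in> {a..b} \<Longrightarrow> f s0 \<le> f s" and "\<eta> > 0"
  obtains C where "- f s0 < C" "C < - f s0 + \<eta>" "T < transit_time f a b C"
proof -
  obtain K where K: "K > 0" "\<And>s t. s \<in> {a..b} \<Longrightarrow> t \<in> {a..b} \<Longrightarrow> \<bar>f s - f t\<bar> \<le> K * \<bar>s - t\<bar>"
    using lipschitz_from_point[OF f ab] by blast
  obtain c k where c: "c > 0" "\<And>y. 0 < y \<Longrightarrow> c / y - k \<le> slowness y"
    using slowness_ge_reciprocal by blast
  \<comment> \<open>\<open>N\<close> is the value of \<open>K * (b - a) / \<delta>\<close> from which on the logarithmic lower bound exceeds \<open>T\<close>.\<close>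
  define N where "N = exp (K * (T + k * (b - a)) / c)"
  have "N > 0" by (simp add: N_def)
  define \<delta> where "\<delta> = min (\<eta> / 2) (K * (b - a) / N)"
  have "0 < K * (b - a) / N" using ab K(1) \<open>N > 0\<close> by simp
  then have \<delta>: "0 < \<delta>" "\<delta> < \<eta>" "\<delta> \<le> K * (b - a) / N"
    using \<open>\<eta> > 0\<close> unfolding \<delta>_def by linarith+
  let ?C = "- f s0 + \<delta>" and ?d = "\<lambda>s. 1 / (K * \<bar>s - s0\<bar> + \<delta>)"
  have pos: "0 < K * \<bar>s - s0\<bar> + \<delta>" for s using K(1) \<delta>(1) by (intro add_nonneg_pos) auto
  have d_cont: "continuous_on {a..b} ?d"
    using pos by (intro continuous_intros) (metis less_irrefl)
  have "N \<le> K * (b - a) / \<delta>" using \<delta> \<open>N > 0\<close> by (simp add: field_simps)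
  then have "ln N < ln (1 + K * (b - a) / \<delta>)" using \<open>N > 0\<close> by simp
  then have "T + k * (b - a) < c * (ln (1 + K * (b - a) / \<delta>) / K)"
    using c(1) K(1) by (simp add: N_def field_simps)
  also have "\<dots> \<le> c * integral {a..b} ?d"
    using integral_reciprocal_distance_ge[OF K(1) \<delta>(1), of a s0 b] m(1) c(1)
    by (intro mult_left_mono) auto
  also have "\<dots> = integral {a..b} (\<lambda>s. c * ?d s - k) + k * (b - a)"
  proof -
    have "integral {a..b} (\<lambda>s. c * ?d s - k) = integral {a..b} (\<lambda>s. c * ?d s) - integral {a..b} (\<lambda>s. k)"
      by (rule integral_diff) (intro integrable_continuous_real continuous_intros d_cont)+
    also have "integral {a..b} (\<lambda>s. c * ?d s) = c * integral {a..b} ?d" by (rule integral_mult_right)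
    finally show ?thesis using ab by simp
  qed
  finally have "T < integral {a..b} (\<lambda>s. c * ?d s - k)" by simp
  also have "\<dots> \<le> transit_time f a b ?C"
    unfolding transit_time_def
  proof (rule integral_le)
    fix s assume s: "s \<in> {a..b}"
    have "f s + ?C \<le> K * \<bar>s - s0\<bar> + \<delta>" using K(2)[OF s m(1)] by linarith
    moreover have "0 < f s + ?C" using m(2)[OF s] \<delta>(1) by linarith
    ultimately have "slowness (K * \<bar>s - s0\<bar> + \<delta>) \<le> slowness (f s + ?C)" by (intro slowness_antimono)
    then show "c * ?d s - k \<le> slowness (f s + ?C)" using c(2)[OF pos[of s]] by simp
  next
    have "continuous_on {a..b} f" using C2_on_UNIV_DERIV(2)[OF f] by (rule continuous_on_subset) simp
    then show "(\<lambda>s. slowness (f s + ?C)) integrable_on {a..b}" using m(2) \<delta>(1)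
      by (intro integrable_continuous_real continuous_on_slowness_comp) force+
  qed (intro integrable_continuous_real continuous_intros d_cont)
  finally show ?thesis using that[of ?C] \<delta> by auto
qed

end

section \<open>Increasing solutions and trajectories\<close>

locale increasing_bvp = saturating_flux +
  fixes f :: "real \<Rightarrow> real" and \<epsilon> L um up :: real
  assumes f_C2: "C2_on UNIV f"
    and eps_pos: "\<epsilon> > 0" and L_pos: "L > 0" and um_less_up: "um < up"
begin

lemma f_cont: "continuous_on S f"
  using C2_on_UNIV_DERIV(2)[OF f_C2] by (rule continuous_on_subset) simp

definition admissible :: "real \<Rightarrow> bool" where
  "admissible C \<longleftrightarrow> (\<forall>u\<in>{um..up}. 0 < f u + C \<and> f u + C < Qinf)"

text \<open>The differential equation is the once integrated equation \<open>Q (\<epsilon> * v') = f v + C\<close>, solved for \<open>v'\<close>.\<close>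

definition trajectory :: "real \<Rightarrow> (real \<Rightarrow> real) \<Rightarrow> bool" where
  "trajectory C v \<longleftrightarrow> v (- L) = um \<and> v L = up \<and>
     (\<forall>x\<in>{-L..L}. v x \<in> {um..up} \<and>
        (v has_real_derivative inv Q (f (v x) + C) / \<epsilon>) (at x within {-L..L}))"

text \<open>The right-hand side \<open>inv Q (f v + C) / \<epsilon>\<close> is a \<open>C\<^sup>1\<close> function of \<open>v\<close> with positive values, so \<open>v\<close> is \<open>C\<^sup>2\<close>
  up to the boundary and strictly increasing.\<close>

lemma trajectory_imp_solution:
  assumes C: "admissible C" and v: "trajectory C v"
  shows "smooth_solution f Q \<epsilon> L um up v" and "strict_mono_on {-L..L} v"
proof -
  define v' where "v' x = inv Q (f (v x) + C) / \<epsilon>" for x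
  have v_deriv: "(v has_real_derivative v' x) (at x within {-L..L})" if "x \<in> {-L..L}" for x
    using v that by (auto simp: trajectory_def v'_def)
  have v_range: "0 < f (v x) + C" "f (v x) + C < Qinf" if "x \<in> {-L..L}" for x
    using C v that by (auto simp: trajectory_def admissible_def)
  have v'_pos: "0 < v' x" if "x \<in> {-L..L}" for x
    using inv_Q_pos v_range[OF that] eps_pos by (simp add: v'_def)
  have v_cont: "continuous_on {-L..L} v" using v_deriv by (rule DERIV_continuous_on)
  have fv_deriv: "((\<lambda>x. f (v x)) has_real_derivative deriv f (v x) * v' x) (at x within {-L..L})"
    if "x \<in> {-L..L}" for x
    using DERIV_chain2[OF C2_on_UNIV_DERIV(1)[OF f_C2] v_deriv[OF that]] .
  define v'' where "v'' x = inverse (deriv Q (inv Q (f (v x) + C))) * (deriv f (v x) * v' x) / \<epsilon>" for x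
  have v'_deriv: "(v' has_real_derivative v'' x) (at x within {-L..L})" if "x \<in> {-L..L}" for x
  proof -
    have "((\<lambda>x. f (v x) + C) has_real_derivative deriv f (v x) * v' x) (at x within {-L..L})"
      using fv_deriv[OF that] by (auto intro!: derivative_eq_intros)
    from DERIV_cdivide[OF DERIV_chain2[where f = "inv Q", OF inv_Q_DERIV[OF v_range[OF that]] this], of \<epsilon>]
    show ?thesis by (simp add: v'_def[abs_def] v''_def)
  qed
  have v'_cont: "continuous_on {-L..L} v'" using v'_deriv by (rule DERIV_continuous_on)
  have "continuous_on {-L..L} v''"
  proof -
    have "continuous_on {-L..L} (\<lambda>x. inv Q (f (v x) + C))"
      using continuous_on_mult_left[OF v'_cont, of \<epsilon>] eps_pos by (simp add: v'_def)
    then show ?thesis unfolding v''_def using Q_deriv_pos eps_pos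
      by (intro continuous_intros v'_cont continuous_on_compose2[OF C2_on_UNIV_DERIV(3)[OF Q_C2]]
            continuous_on_compose2[OF C2_on_UNIV_DERIV(3)[OF f_C2] v_cont])
         (auto simp: less_imp_neq[THEN not_sym])
  qed
  then have "C2_on {-L..L} v" unfolding C2_on_def using v_deriv v'_deriv by blast
  moreover have "deriv (\<lambda>y. Q (\<epsilon> * deriv v y)) x = deriv (\<lambda>y. f (v y)) x" if x: "x \<in> {-L<..<L}" for x
  proof -
    have fv: "((\<lambda>y. f (v y)) has_real_derivative deriv f (v x) * v' x) (at x)"
      using fv_deriv[of x] x by (simp add: at_within_Icc_at)
    have fi: "f (v y) + C = Q (\<epsilon> * deriv v y)" if y: "y \<in> {-L<..<L}" for y
    proof -
      have "deriv v y = v' y" using v_deriv[of y] y by (auto intro!: DERIV_imp_deriv simp: at_within_Icc_at)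
      then show ?thesis using Q_inv_Q v_range[of y] y eps_pos by (simp add: v'_def)
    qed
    have "((\<lambda>y. f (v y) + C) has_real_derivative deriv f (v x) * v' x) (at x)"
      using fv by (auto intro!: derivative_eq_intros)
    then have "((\<lambda>y. Q (\<epsilon> * deriv v y)) has_real_derivative deriv f (v x) * v' x) (at x)"
      by (rule has_field_derivative_transform_within_open[OF _ open_greaterThanLessThan x fi])
    with fv show ?thesis by (simp add: DERIV_imp_deriv)
  qed
  ultimately show "smooth_solution f Q \<epsilon> L um up v"
    using v by (auto simp: smooth_solution_def trajectory_def)
  show "strict_mono_on {-L..L} v"
  proof (rule strict_mono_onI)
    fix x y assume xy: "x \<in> {-L..L}" "y \<in> {-L..L}" "x < y"
    show "v x < v y"
    proof (rule DERIV_pos_imp_increasing_open[OF xy(3)])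
      fix z assume "x < z" "z < y"
      then show "\<exists>d. (v has_real_derivative d) (at z) \<and> 0 < d"
        using v_deriv[of z] v'_pos[of z] xy by (auto simp: at_within_Icc_at)
    qed (use xy in \<open>auto intro: continuous_on_subset[OF v_cont]\<close>)
  qed
qed

text \<open>A strictly increasing function may have a critical point, but a solution may not: if \<open>v' x0 = 0\<close>, then
  \<open>v x0\<close> is a zero of \<open>f + C\<close>, that is, an equilibrium, and the Lipschitz continuity of \<open>f\<close> gives
  \<open>v' \<le> K * \<bar>v - v x0\<bar>\<close>. By Gronwall's inequality, \<open>v\<close> stays at \<open>v x0\<close>, which contradicts strict
  monotonicity.\<close>

lemma increasing_solution_slope_pos:
  assumes v: "strict_mono_on {-L..L} v"
    and v_deriv: "\<And>x. x \<in> {-L..L} \<Longrightarrow> (v has_real_derivative v' x) (at x within {-L..L})"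
    and v'_cont: "continuous_on {-L..L} v'"
    and first_integral: "\<And>x. x \<in> {-L..L} \<Longrightarrow> Q (\<epsilon> * v' x) = f (v x) + C"
    and x0: "x0 \<in> {-L..L}"
  shows "0 < v' x0"
proof (rule ccontr)
  assume not_pos: "\<not> 0 < v' x0"
  have v'_nonneg: "0 \<le> v' x" if x: "x \<in> {-L..L}" for x
  proof (rule ccontr)
    assume "\<not> 0 \<le> v' x"
    then have neg: "v' x < 0" by simp
    show False
    proof (cases "x < L")
      case True
      obtain d where "d > 0" and d: "\<And>h. h > 0 \<Longrightarrow> x + h \<in> {-L..L} \<Longrightarrow> h < d \<Longrightarrow> v (x + h) < v x"
        using has_real_derivative_neg_dec_right[OF v_deriv[OF x] neg] by blast
      let ?h = "min (d / 2) (L - x)"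
      have h: "0 < ?h" "x + ?h \<in> {-L..L}" "?h < d" using x True \<open>d > 0\<close> by auto
      with d[OF h] strict_mono_onD[OF v x h(2)] show False by simp
    next
      case False
      obtain d where "d > 0" and d: "\<And>h. h > 0 \<Longrightarrow> x - h \<in> {-L..L} \<Longrightarrow> h < d \<Longrightarrow> v x < v (x - h)"
        using has_real_derivative_neg_dec_left[OF v_deriv[OF x] neg] by blast
      let ?h = "min (d / 2) L"
      have h: "0 < ?h" "x - ?h \<in> {-L..L}" "?h < d" using x False \<open>d > 0\<close> L_pos by auto
      with d[OF h] strict_mono_onD[OF v h(2) x] show False by simp
    qed
  qed
  with not_pos x0 have "v' x0 = 0" by force
  then have C: "f (v x0) + C = 0" using first_integral[OF x0] Q_0 by simp
  have v_cont: "continuous_on {-L..L} v" using v_deriv by (rule DERIV_continuous_on)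
  have v_less: "v (- L) < v L" using strict_mono_onD[OF v] L_pos by simp
  have v_range: "v x \<in> {v (- L)..v L}" if "x \<in> {-L..L}" for x
    using that L_pos by (auto intro!: mono_onD[OF strict_mono_on_imp_mono_on[OF v]])
  have "compact (v' ` {-L..L})" by (intro compact_continuous_image v'_cont) simp
  then obtain B where B: "B > 0" "\<And>x. x \<in> {-L..L} \<Longrightarrow> v' x \<le> B"
    by (force dest!: compact_imp_bounded simp: bounded_pos)
  obtain c where c: "c > 0" "\<And>p. 0 \<le> p \<Longrightarrow> p \<le> \<epsilon> * B \<Longrightarrow> c * p \<le> Q p"
    using Q_ge_linear[of "\<epsilon> * B"] B(1) eps_pos by auto
  obtain k where k: "\<And>s t. s \<in> {v (- L)..v L} \<Longrightarrow> t \<in> {v (- L)..v L} \<Longrightarrow> \<bar>f s - f t\<bar> \<le> k * \<bar>s - t\<bar>"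
    using lipschitz_from_point[OF f_C2 v_less] by blast
  define K where "K = k / (c * \<epsilon>)"
  have v'_le: "v' x \<le> K * \<bar>v x - v x0\<bar>" if x: "x \<in> {-L..L}" for x
  proof -
    have "c * (\<epsilon> * v' x) \<le> Q (\<epsilon> * v' x)"
      using v'_nonneg[OF x] B(2)[OF x] eps_pos by (intro c(2)) auto
    also have "\<dots> = f (v x) - f (v x0)" using first_integral[OF x] C by simp
    also have "\<dots> \<le> k * \<bar>v x - v x0\<bar>" using k[OF v_range[OF x] v_range[OF x0]] by linarith
    finally show ?thesis using c(1) eps_pos by (simp add: K_def field_simps)
  qed
  have v_at: "(v has_real_derivative v' x) (at x)" if "- L < x" "x < L" for x
    using v_deriv[of x] that by (simp add: at_within_Icc_at)
  show False
  proof (cases "x0 < L")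
    case True
    have "v L - v x0 \<le> 0"
    proof (rule gronwall_nonpos[of x0 L "\<lambda>x. v x - v x0" v' K])
      fix x assume x: "x0 < x" "x < L"
      show "((\<lambda>x. v x - v x0) has_real_derivative v' x) (at x)"
        using x x0 by (auto intro!: derivative_eq_intros v_at)
      show "v' x \<le> K * (v x - v x0)"
        using v'_le[of x] strict_mono_onD[OF v x0, of x] x x0 by simp
    qed (use True x0 in \<open>auto intro!: continuous_intros continuous_on_subset[OF v_cont]\<close>)
    with strict_mono_onD[OF v x0, of L] True L_pos show False by simp
  next
    case False
    then have [simp]: "x0 = L" using x0 by simp
    \<comment> \<open>At the right end point there is no room to the right; reflection turns the interval around.\<close>
    have "v x0 - v (- L) \<le> 0"
    proof (rule gronwall_nonpos[of "- L" L "\<lambda>y. v x0 - v (- y)" "\<lambda>y. v' (- y)" K])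
      show "continuous_on {-L..L} (\<lambda>y. v x0 - v (- y))"
        by (intro continuous_intros continuous_on_compose2[OF v_cont]) auto
      fix y assume y: "- L < y" "y < L"
      have "((\<lambda>y. v (- y)) has_real_derivative - v' (- y)) (at y)"
        using v_at[of "- y"] y by (simp add: DERIV_mirror)
      then show "((\<lambda>y. v x0 - v (- y)) has_real_derivative v' (- y)) (at y)"
        by (auto intro!: derivative_eq_intros)
      show "v' (- y) \<le> K * (v x0 - v (- y))"
        using v'_le[of "- y"] strict_mono_onD[OF v _ x0, of "- y"] y by simp
    qed (use L_pos in auto)
    with v_less show False by simp
  qed
qed

text \<open>The constant of integration \<open>C\<close> is admissible because \<open>v\<close> attains every value in \<open>{um..up}\<close> and
  \<open>Q (\<epsilon> * v' x)\<close> lies strictly between \<open>Q 0 = 0\<close> and \<open>Qinf\<close>.\<close>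

lemma solution_imp_trajectory:
  assumes sol: "smooth_solution f Q \<epsilon> L um up v" and mono: "strict_mono_on {-L..L} v"
  shows "\<exists>C. admissible C \<and> trajectory C v"
proof -
  from sol obtain v' v'' where
      v_deriv: "\<And>x. x \<in> {-L..L} \<Longrightarrow> (v has_real_derivative v' x) (at x within {-L..L})"
      and v'_deriv: "\<And>x. x \<in> {-L..L} \<Longrightarrow> (v' has_real_derivative v'' x) (at x within {-L..L})"
    unfolding smooth_solution_def C2_on_def by blast
  from sol have pde: "\<And>x. x \<in> {-L<..<L} \<Longrightarrow> deriv (\<lambda>y. Q (\<epsilon> * deriv v y)) x = deriv (\<lambda>y. f (v y)) x"
      and bc: "v (- L) = um" "v L = up"
    unfolding smooth_solution_def by auto
  have v_cont: "continuous_on {-L..L} v" using v_deriv by (rule DERIV_continuous_on)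
  have v'_cont: "continuous_on {-L..L} v'" using v'_deriv by (rule DERIV_continuous_on)
  let ?D = "\<lambda>x. Q (\<epsilon> * v' x) - f (v x)"
  have D_deriv: "(?D has_real_derivative 0) (at x)" if "- L < x" "x < L" for x
  proof -
    have x: "x \<in> {-L<..<L}" using that by simp
    have "(v has_real_derivative v' x) (at x)" "(v' has_real_derivative v'' x) (at x)"
      using v_deriv[of x] v'_deriv[of x] x by (simp_all add: at_within_Icc_at)
    note d = this
    have Qv: "((\<lambda>y. Q (\<epsilon> * v' y)) has_real_derivative deriv Q (\<epsilon> * v' x) * (\<epsilon> * v'' x)) (at x)"
      by (rule DERIV_chain2[OF Q_DERIV]) (auto intro!: derivative_eq_intros d)
    have fv: "((\<lambda>y. f (v y)) has_real_derivative deriv f (v x) * v' x) (at x)"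
      by (rule DERIV_chain2[OF C2_on_UNIV_DERIV(1)[OF f_C2] d(1)])
    have dv: "deriv v y = v' y" if "y \<in> {-L<..<L}" for y
      using v_deriv[of y] that by (auto intro!: DERIV_imp_deriv simp: at_within_Icc_at)
    have "((\<lambda>y. Q (\<epsilon> * deriv v y)) has_real_derivative deriv Q (\<epsilon> * v' x) * (\<epsilon> * v'' x)) (at x)"
      by (rule has_field_derivative_transform_within_open[OF Qv _ x]) (auto simp: dv)
    with pde[OF x] fv have "deriv Q (\<epsilon> * v' x) * (\<epsilon> * v'' x) = deriv f (v x) * v' x"
      by (simp add: DERIV_imp_deriv)
    with DERIV_diff[OF Qv fv] show ?thesis by simp
  qed
  define C where "C = ?D (- L)"
  have "?D x = C" if "x \<in> {-L..L}" for x
    unfolding C_def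
  proof (rule DERIV_isconst2[OF _ _ D_deriv])
    show "continuous_on {-L..L} ?D"
      by (intro continuous_intros v'_cont v_cont continuous_on_compose2[OF C2_on_UNIV_DERIV(2)[OF Q_C2]]
            continuous_on_compose2[OF f_cont[of UNIV] v_cont]) auto
  qed (use that L_pos in auto)
  then have first_integral: "Q (\<epsilon> * v' x) = f (v x) + C" if "x \<in> {-L..L}" for x
    using that by (simp add: algebra_simps)
  have v'_pos: "0 < v' x" if "x \<in> {-L..L}" for x
    using mono v_deriv v'_cont first_integral that by (rule increasing_solution_slope_pos)
  show ?thesis
  proof (intro exI conjI)
    show "admissible C" unfolding admissible_def
    proof
      fix u assume "u \<in> {um..up}"
      then have "\<exists>x\<ge>- L. x \<le> L \<and> v x = u" using bc v_cont L_pos by (intro IVT') auto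
      then obtain x where x: "x \<in> {-L..L}" "v x = u" by auto
      moreover have "Q 0 < Q (\<epsilon> * v' x)" using v'_pos[OF x(1)] eps_pos by simp
      ultimately show "0 < f u + C \<and> f u + C < Qinf"
        using first_integral[OF x(1)] Q_less_Qinf[of "\<epsilon> * v' x"] Q_0 by simp
    qed
    show "trajectory C v" unfolding trajectory_def
    proof (intro conjI ballI)
      fix x assume x: "x \<in> {-L..L}"
      show "v x \<in> {um..up}"
        using x L_pos by (auto simp: bc[symmetric] intro!: mono_onD[OF strict_mono_on_imp_mono_on[OF mono]])
      have "inv Q (f (v x) + C) / \<epsilon> = v' x"
        using first_integral[OF x, symmetric] eps_pos by simp
      then show "(v has_real_derivative inv Q (f (v x) + C) / \<epsilon>) (at x within {-L..L})"
        using v_deriv[OF x] by simp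
    qed (use bc in auto)
  qed
qed

lemma slowness_along_interval:
  assumes "admissible C"
  shows "continuous_on {um..up} (\<lambda>s. slowness (f s + C))"
    and "s \<in> {um..up} \<Longrightarrow> 0 < slowness (f s + C)"
    and "s \<in> {um..up} \<Longrightarrow> 1 / (\<epsilon> * slowness (f s + C)) = inv Q (f s + C) / \<epsilon>"
  using assms by (auto simp: admissible_def slowness_def[of "f s + C"] inv_Q_pos f_cont intro!: continuous_on_slowness_comp)

lemma trajectory_travel_time:
  assumes C: "admissible C" and v: "trajectory C v" and x: "x \<in> {-L..L}"
  shows "integral {um..v x} (\<lambda>s. slowness (f s + C)) = (x + L) / \<epsilon>"
proof -
  have "integral {um..v x} (\<lambda>s. \<epsilon> * slowness (f s + C)) = x - (- L)"
  proof (rule elapsed_time_eq_integral[OF _ _ _ _ _ x])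
    show "continuous_on {um..up} (\<lambda>s. \<epsilon> * slowness (f s + C))"
      by (intro continuous_intros slowness_along_interval C)
    show "\<epsilon> * slowness (f s + C) \<noteq> 0" if "s \<in> {um..up}" for s
      using slowness_along_interval(2)[OF C that] eps_pos by simp
    show "(v has_real_derivative 1 / (\<epsilon> * slowness (f (v y) + C))) (at y within {-L..L})"
      if "y \<in> {-L..L}" for y
    proof -
      have "v y \<in> {um..up}" using v that unfolding trajectory_def by blast
      from slowness_along_interval(3)[OF C this] v that show ?thesis by (simp add: trajectory_def)
    qed
  qed (use v in \<open>auto simp: trajectory_def\<close>)
  then show ?thesis using eps_pos by (simp add: field_simps)
qed

lemma trajectory_transit_time:
  assumes "admissible C" and "trajectory C v"
  shows "transit_time f um up C = 2 * L / \<epsilon>"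
  using trajectory_travel_time[OF assms, of L] assms(2) L_pos
  by (simp add: transit_time_def trajectory_def)

lemma trajectory_exists:
  assumes C: "admissible C" and T: "transit_time f um up C = 2 * L / \<epsilon>"
  obtains v where "v \<in> extensional {-L..L}" "trajectory C v"
proof -
  obtain v where v: "v (- L) = um" "v L = up" "v ` {-L..L} \<subseteq> {um..up}"
    "\<And>x. x \<in> {-L..L} \<Longrightarrow> (v has_real_derivative 1 / (\<epsilon> * slowness (f (v x) + C))) (at x within {-L..L})"
  proof (rule solution_by_quadrature[OF um_less_up])
    show "continuous_on {um..up} (\<lambda>s. \<epsilon> * slowness (f s + C))"
      by (intro continuous_intros slowness_along_interval C)
    show "0 < \<epsilon> * slowness (f s + C)" if "s \<in> {um..up}" for s
      using slowness_along_interval(2)[OF C that] eps_pos by simp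
    show "L - (- L) = integral {um..up} (\<lambda>s. \<epsilon> * slowness (f s + C))"
      using T eps_pos by (simp add: transit_time_def)
  qed blast
  have "trajectory C (restrict v {-L..L})" unfolding trajectory_def
  proof (intro conjI ballI)
    fix x assume x: "x \<in> {-L..L}"
    have "(v has_real_derivative inv Q (f (v x) + C) / \<epsilon>) (at x within {-L..L})"
    proof -
      have "v x \<in> {um..up}" using v(3) x by blast
      from slowness_along_interval(3)[OF C this] v(4)[OF x] show ?thesis by simp
    qed
    then have "(restrict v {-L..L} has_real_derivative inv Q (f (v x) + C) / \<epsilon>) (at x within {-L..L})"
      by (rule has_field_derivative_transform_within[where d = 1]) (use x in auto)
    then show "(restrict v {-L..L} has_real_derivative inv Q (f (restrict v {-L..L} x) + C) / \<epsilon>) (at x within {-L..L})"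
      using x by simp
    show "restrict v {-L..L} x \<in> {um..up}" using v(3) x by (simp add: image_subset_iff)
  qed (use v L_pos in auto)
  from that[OF restrict_extensional this] show ?thesis .
qed

text \<open>The length \<open>2 * L\<close> determines \<open>C\<close>, since the transit time is strictly decreasing in it. Then both
  functions reach every level at the same point.\<close>

lemma trajectory_unique:
  assumes C: "admissible C" and v: "trajectory C v"
    and D: "admissible D" and w: "trajectory D w" and x: "x \<in> {-L..L}"
  shows "v x = w x"
proof -
  have T: "transit_time f um up C = transit_time f um up D"
    using trajectory_transit_time[OF C v] trajectory_transit_time[OF D w] by simp
  have "\<not> C < D" "\<not> D < C"
    using transit_time_strict_antimono[OF f_cont um_less_up, of C D] C
      transit_time_strict_antimono[OF f_cont um_less_up, of D C] D T
    by (auto simp: admissible_def)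
  then have [simp]: "D = C" by simp
  let ?r = "\<lambda>s. slowness (f s + C)"
  have eq: "integral {um..v x} ?r = integral {um..w x} ?r"
    using trajectory_travel_time[OF C v x] trajectory_travel_time[OF D w x] by simp
  have less: "integral {um..p} ?r < integral {um..q} ?r" if "um \<le> p" "p < q" "q \<le> up" for p q
  proof -
    have cont: "continuous_on {um..q} ?r" "continuous_on {p..q} ?r"
      using that by (auto intro!: continuous_on_subset[OF slowness_along_interval(1)[OF C]])
    have "integral {p..q} (\<lambda>_. 0) < integral {p..q} ?r"
      using that slowness_along_interval(2)[OF C] by (intro integral_less_real cont) auto
    moreover have "integral {um..p} ?r + integral {p..q} ?r = integral {um..q} ?r"
      using Henstock_Kurzweil_Integration.integral_combine[of um p q ?r] integrable_continuous_real[OF cont(1)] that by simp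
    ultimately show ?thesis by simp
  qed
  have "v x \<in> {um..up}" "w x \<in> {um..up}" using v w x unfolding trajectory_def by blast+
  with eq less[of "v x" "w x"] less[of "w x" "v x"] show ?thesis
    by (cases "v x" "w x" rule: linorder_cases) auto
qed

section \<open>Solvability\<close>

abbreviation "M \<equiv> max_on f {um..up}"
abbreviation "m \<equiv> min_on f {um..up}"

lemma admissible_iff: "admissible C \<longleftrightarrow> - m < C \<and> C < Qinf - M"
proof
  assume C: "admissible C"
  have "M \<in> f ` {um..up}" "m \<in> f ` {um..up}"
    using max_on_Icc(1)[OF f_cont] min_on_Icc(1)[OF f_cont] um_less_up by auto
  then obtain sM sm where "sM \<in> {um..up}" "M = f sM" "sm \<in> {um..up}" "m = f sm" by blast
  moreover from this C have "f sM + C < Qinf" "0 < f sm + C" unfolding admissible_def by blast+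
  ultimately show "- m < C \<and> C < Qinf - M" by linarith
next
  assume C: "- m < C \<and> C < Qinf - M"
  show "admissible C" unfolding admissible_def
  proof
    fix u assume "u \<in> {um..up}"
    then have "f u \<le> M" "m \<le> f u"
      using max_on_Icc(2)[OF f_cont] min_on_Icc(2)[OF f_cont] um_less_up by auto
    with C show "0 < f u + C \<and> f u + C < Qinf" by linarith
  qed
qed

lemma A_integral_eq_transit_time: "A_integral f Q Qinf um up = transit_time f um up (Qinf - M)"
  unfolding A_integral_def transit_time_def Let_def
proof (rule integral_cong)
  fix s assume "s \<in> {um..up}"
  then have "f s \<le> M" using max_on_Icc(2)[OF f_cont] um_less_up by simp
  then show "(if f s = M then 0 else 1 / inv Q (f s + Qinf - M)) = slowness (f s + (Qinf - M))"
    by (auto simp: slowness_def add_diff_eq)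
qed

text \<open>On the admissible interval \<open>C\<close> runs from \<open>- m\<close> to \<open>Qinf - M\<close>, and the transit time decreases strictly
  from infinity to its value \<open>A\<close> at the right end point, which is itself not admissible.\<close>

lemma transit_time_eq_iff:
  "(\<exists>C. admissible C \<and> transit_time f um up C = T) \<longleftrightarrow> M - m < Qinf \<and> A_integral f Q Qinf um up < T"
  (is "?L \<longleftrightarrow> ?R")
proof
  assume ?L
  then obtain C where C: "admissible C" and T: "transit_time f um up C = T" by blast
  then have "- m < C" "C < Qinf - M" by (auto simp: admissible_iff)
  moreover have "transit_time f um up (Qinf - M) < transit_time f um up C"
    using C \<open>C < Qinf - M\<close> by (intro transit_time_strict_antimono f_cont um_less_up) (auto simp: admissible_def)
  ultimately show ?R using T by (simp add: A_integral_eq_transit_time)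
next
  assume R: ?R
  have um_le_up: "um \<le> up" using um_less_up by simp
  obtain s0 where s0: "s0 \<in> {um..up}" "f s0 = m" using min_on_Icc(1)[OF f_cont um_le_up] by force
  have m_le: "m \<le> f s" if "s \<in> {um..up}" for s using min_on_Icc(2)[OF f_cont um_le_up that] .
  obtain C0 where C0: "- m < C0" "C0 < - m + (Qinf - M + m)" "T < transit_time f um up C0"
    using transit_time_unbounded[OF f_C2 um_less_up s0(1), of "Qinf - M + m" T] R s0(2) m_le by auto
  have "\<exists>C\<ge>C0. C \<le> Qinf - M \<and> transit_time f um up C = T"
  proof (rule IVT2')
    show "continuous_on {C0..Qinf - M} (transit_time f um up)"
      by (rule continuous_on_subset[OF continuous_on_transit_time[OF f_cont, of um up m]])
         (use C0 m_le in auto)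
  qed (use C0 R in \<open>auto simp: A_integral_eq_transit_time\<close>)
  then obtain C where C: "C0 \<le> C" "C \<le> Qinf - M" "transit_time f um up C = T" by blast
  moreover have "C \<noteq> Qinf - M" using C(3) R by (auto simp: A_integral_eq_transit_time)
  moreover have "- m < C" using C0(1) C(1) by linarith
  ultimately show ?L unfolding admissible_iff by (intro exI[of _ C]) simp
qed

lemma ex1_increasing_solution_iff:
  "(\<exists>!v. v \<in> extensional {-L..L} \<and> smooth_solution f Q \<epsilon> L um up v \<and> strict_mono_on {-L..L} v)
   \<longleftrightarrow> (\<exists>C. admissible C \<and> transit_time f um up C = 2 * L / \<epsilon>)"
  (is "(\<exists>!v. ?S v) \<longleftrightarrow> ?T")
proof
  assume "\<exists>!v. ?S v"
  then obtain v where "?S v" by blast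
  then obtain C where "admissible C" "trajectory C v" using solution_imp_trajectory by blast
  then show ?T using trajectory_transit_time by blast
next
  assume ?T
  then obtain C v where "v \<in> extensional {-L..L}" "admissible C" "trajectory C v"
    using trajectory_exists by metis
  note v = this
  show "\<exists>!v. ?S v"
  proof (rule ex1I)
    show "?S v" using v trajectory_imp_solution by blast
    fix w assume w: "?S w"
    then obtain D where D: "admissible D" "trajectory D w" using solution_imp_trajectory by blast
    show "w = v"
    proof (rule extensionalityI)
      show "w \<in> extensional {-L..L}" "v \<in> extensional {-L..L}" using w v(1) by simp_all
      show "w x = v x" if "x \<in> {-L..L}" for x using D v(2,3) that by (rule trajectory_unique)
    qed
  qed
qed

end

theorem proposition2p1:
  fixes f Q :: "real \<Rightarrow> real" and \<epsilon> L Qinf um up :: real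
  assumes "\<epsilon> > 0" and "L > 0" and "Qinf > 0"
    and "C2_on UNIV f" and "C2_on UNIV Q"
    and "Q 0 = 0"
    and "(Q \<longlongrightarrow> Qinf) at_top" and "(Q \<longlongrightarrow> - Qinf) at_bot"
    and "\<forall>s. deriv Q s > 0"
    and "(deriv Q \<longlongrightarrow> 0) at_infinity"
    and "um < up"
  shows "(\<exists>!v. v \<in> extensional {-L..L} \<and> smooth_solution f Q \<epsilon> L um up v \<and>
               strict_mono_on {-L..L} v) \<longleftrightarrow>
         max_on f {um..up} - min_on f {um..up} < Qinf \<and>
         2 * L / \<epsilon> > A_integral f Q Qinf um up"
proof -
  interpret increasing_bvp Q Qinf f \<epsilon> L um up
    by unfold_locales (use assms in auto)
  show ?thesis
    unfolding ex1_increasing_solution_iff transit_time_eq_iff ..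
qed

end
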